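(* Let $\alpha$ denote the arrow pattern $(12;1\to 3)$, and for $\pi\in\mathfrak{S}_3$ and $n\ge 1$ let $a_n(\pi,\alpha)$ be the number of permutations in $\mathfrak{S}_n$ that avoid both the classical pattern $\pi$ and the arrow pattern $\alpha$. Then for every integer $n\ge 2$, $$a_n(132,\alpha)=a_n(312,\alpha)=C_n,$$ where $C_n=\frac{1}{n+1}\binom{2n}{n}$ is the $n$-th Catalan number.
   Context: $\mathfrak{S}_n$ is the set of permutations of $[n]=\{1,\dots,n\}$, written in one-line notation $\sigma=\sigma_1\cdots\sigma_n$ with $\sigma_i=\sigma(i)$. A permutation $\sigma\in\mathfrak{S}_n$ contains the classical pattern $\pi\in\mathfrak{S}_m$ if there are $1\le i_1<\cdots<i_m\le n$ such that $\sigma_{i_1}\cdots\sigma_{i_m}$ is order-isomorphic to $\pi$; otherwise it avoids $\pi$. Standard cycle notation: every cycle (including fixed points) is written as $(a\ \sigma(a)\ \sigma^2(a)\cdots)$ beginning with its maximal element $a$, and the cycles are listed from left to right in increasing order of their maximal elements. The bijection $\Phi:\mathfrak{S}_n\to\mathfrak{S}_n$ sends $\sigma$ to the permutation whose one-line notation is obtained by erasing the parentheses in the standard cycle notation of $\sigma$. For $\sigma\in\mathfrak{S}_n$ write $\hat\sigma=\Phi^{-1}(\sigma)$. An arrow pattern of size $k$ is a pair $(\nu;H)$ with $\nu=a_1\ldots a_m$ a string of positive integers and $H=\{b_i\to c_i:1\le i\le h\}$ a (possibly empty) set of arrows, such that the distinct integers appearing in $\nu$ or $H$ form $[k]$. A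 permutation $\sigma\in\mathfrak{S}_n$ contains $(\nu;H)$ if there is a subset $X=\{x_1<\cdots<x_k\}\subseteq[n]$ such that (1) $\sigma_{t_1}\cdots\sigma_{t_m}=x_{a_1}\cdots x_{a_m}$ for some indices $t_1<\cdots<t_m$, and (2) $\hat\sigma(x_{b_i})=x_{c_i}$ for all $1\le i\le h$; otherwise $\sigma$ avoids it. In particular, $\sigma$ contains $\alpha=(12;1\to3)$ iff there exist $x_1<x_2<x_3$ in $[n]$ such that $x_1$ appears to the left of $x_2$ in the one-line notation of $\sigma$ and $\hat\sigma(x_1)=x_3$. *)

theory Defs
  imports Complex_Main "HOL-Combinatorics.Combinatorics"
begin

text \<open>Elements of the symmetric group on \<open>[n]\<close> are the functions \<open>\<sigma>\<close> with
  \<open>\<sigma> permutes {1..n}\<close>; they are the identity outside \<open>{1..n}\<close>, so counting them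
  counts permutations of \<open>[n]\<close>.\<close>

definition perms :: "nat \<Rightarrow> (nat \<Rightarrow> nat) set" where
  "perms n = {\<sigma>. \<sigma> permutes {1..n}}"

text \<open>The function whose one-line notation is the word \<open>w\<close>. Positions are counted
  from 1, list indices from 0.\<close>

definition perm_of_word :: "nat list \<Rightarrow> nat \<Rightarrow> nat" where
  "perm_of_word w i = (if 1 \<le> i \<and> i \<le> length w then w ! (i - 1) else i)"

definition contains_classical ::
    "nat \<Rightarrow> (nat \<Rightarrow> nat) \<Rightarrow> nat \<Rightarrow> (nat \<Rightarrow> nat) \<Rightarrow> bool" where
  "contains_classical n \<sigma> m \<pi> \<longleftrightarrow>
     (\<exists>t. strict_mono_on {1..m} t \<and> t ` {1..m} \<subseteq> {1..n} \<and>
          (\<forall>i\<in>{1..m}. \<forall>j\<in>{1..m}. \<sigma> (t i) < \<sigma> (t j) \<longleftrightarrow> \<pi> i < \<pi> j))"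

text \<open>\<open>support \<sigma> a\<close> is the list \<open>[a, \<sigma> a, \<sigma> (\<sigma> a), \<dots>]\<close> running once through the
  cycle of \<open>a\<close>; it is \<open>[a]\<close> for a fixed point.\<close>

definition cycle_maxima :: "nat \<Rightarrow> (nat \<Rightarrow> nat) \<Rightarrow> nat set" where
  "cycle_maxima n \<sigma> = {a \<in> {1..n}. \<forall>x \<in> set (support \<sigma> a). x \<le> a}"

definition standard_cycles :: "nat \<Rightarrow> (nat \<Rightarrow> nat) \<Rightarrow> nat list list" where
  "standard_cycles n \<sigma> = map (support \<sigma>) (sorted_list_of_set (cycle_maxima n \<sigma>))"

definition Phi :: "nat \<Rightarrow> (nat \<Rightarrow> nat) \<Rightarrow> (nat \<Rightarrow> nat)" where
  "Phi n \<sigma> = perm_of_word (concat (standard_cycles n \<sigma>))"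

definition hat :: "nat \<Rightarrow> (nat \<Rightarrow> nat) \<Rightarrow> (nat \<Rightarrow> nat)" where
  "hat n \<sigma> = inv_into (perms n) (Phi n) \<sigma>"

text \<open>An arrow pattern is a pair \<open>(\<nu>, H)\<close>, with \<open>(b, c) \<in> H\<close> standing for the arrow
  \<open>b \<rightarrow> c\<close>. Its size \<open>k\<close> is determined by the requirement that its letters form \<open>[k]\<close>.\<close>

type_synonym arrow_pattern = "nat list \<times> (nat \<times> nat) set"

definition arrow_letters :: "arrow_pattern \<Rightarrow> nat set" where
  "arrow_letters A = set (fst A) \<union> fst ` snd A \<union> snd ` snd A"

definition is_arrow_pattern :: "nat \<Rightarrow> arrow_pattern \<Rightarrow> bool" where
  "is_arrow_pattern k A \<longleftrightarrow> arrow_letters A = {1..k}"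

definition arrow_size :: "arrow_pattern \<Rightarrow> nat" where
  "arrow_size A = card (arrow_letters A)"

text \<open>The subset \<open>X = {x\<^sub>1 < \<dots> < x\<^sub>k}\<close> of \<open>[n]\<close> is given by its increasing
  enumeration \<open>x\<close>. The indices \<open>t j\<close> start at \<open>j = 0\<close>, matching list indexing of \<open>\<nu>\<close>.\<close>

definition contains_arrow :: "nat \<Rightarrow> (nat \<Rightarrow> nat) \<Rightarrow> arrow_pattern \<Rightarrow> bool" where
  "contains_arrow n \<sigma> A \<longleftrightarrow>
     (\<exists>x. strict_mono_on {1..arrow_size A} x \<and> x ` {1..arrow_size A} \<subseteq> {1..n} \<and>
        (\<exists>t. strict_mono_on {..<length (fst A)} t \<and> t ` {..<length (fst A)} \<subseteq> {1..n} \<and>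
             (\<forall>j<length (fst A). \<sigma> (t j) = x (fst A ! j))) \<and>
        (\<forall>(b, c)\<in>snd A. hat n \<sigma> (x b) = x c))"

definition alpha :: arrow_pattern where
  "alpha = ([1, 2], {(1, 3)})"

text \<open>\<open>num_avoid n \<pi> A\<close> is \<open>a\<^sub>n(\<pi>, A)\<close> for a classical pattern \<open>\<pi>\<close> of size 3.\<close>

definition num_avoid :: "nat \<Rightarrow> (nat \<Rightarrow> nat) \<Rightarrow> arrow_pattern \<Rightarrow> nat" where
  "num_avoid n \<pi> A =
     card {\<sigma> \<in> perms n. \<not> contains_classical n \<sigma> 3 \<pi> \<and> \<not> contains_arrow n \<sigma> A}"

definition catalan :: "nat \<Rightarrow> real" where
  "catalan n = 1 / (real n + 1) * real ((2 * n) choose n)"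

lemma alpha_is_arrow_pattern: "is_arrow_pattern 3 alpha"
  by (auto simp: is_arrow_pattern_def arrow_letters_def alpha_def)

lemma arrow_size_alpha: "arrow_size alpha = 3"
  using alpha_is_arrow_pattern by (simp add: is_arrow_pattern_def arrow_size_def)

lemma contains_alpha_iff:
  "contains_arrow n \<sigma> alpha \<longleftrightarrow>
     (\<exists>x1 x2 x3 i j. 1 \<le> x1 \<and> x1 < x2 \<and> x2 < x3 \<and> x3 \<le> n \<and>
        1 \<le> i \<and> i < j \<and> j \<le> n \<and> \<sigma> i = x1 \<and> \<sigma> j = x2 \<and> hat n \<sigma> x1 = x3)"
  (is "?L \<longleftrightarrow> ?R")
proof
  assume ?L
  then obtain x t where x: "strict_mono_on {1..3} x" "x ` {1..3} \<subseteq> {1..n}"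
    and t: "strict_mono_on {..<2} t" "t ` {..<2} \<subseteq> {1..n}"
    and v: "\<forall>j<2. \<sigma> (t j) = x ([1, 2] ! j)" and h: "hat n \<sigma> (x 1) = x (3::nat)"
    unfolding contains_arrow_def arrow_size_alpha by (auto simp: alpha_def numeral_2_eq_2)
  have x': "x 1 < x 2" "x 2 < x 3" "1 \<le> x 1" "x 3 \<le> n"
    using strict_mono_onD[OF x(1), of 1 2] strict_mono_onD[OF x(1), of 2 3] x(2)
    by (auto simp: image_subset_iff)
  have t': "t 0 < t 1" "1 \<le> t 0" "t 1 \<le> n"
    using strict_mono_onD[OF t(1), of 0 1] t(2) by (auto simp: image_subset_iff)
  have v': "\<sigma> (t 0) = x 1" "\<sigma> (t 1) = x 2"
    using v[rule_format, of 0] v[rule_format, of 1] by simp_all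
  show ?R using x' t' v' h by blast
next
  assume ?R
  then obtain x1 x2 x3 i j where R: "1 \<le> x1" "x1 < x2" "x2 < x3" "x3 \<le> n"
    "1 \<le> i" "i < j" "j \<le> n" "\<sigma> i = x1" "\<sigma> j = x2" "hat n \<sigma> x1 = x3" by blast
  define x where "x k = (if k = 1 then x1 else if k = 2 then x2 else x3)" for k :: nat
  define t where "t k = (if k = 0 then i else j)" for k :: nat
  have 1: "strict_mono_on {1..3} x" "x ` {1..3} \<subseteq> {1..n}"
    using R by (auto simp: x_def strict_mono_on_def)
  have 2: "strict_mono_on {..<2} t" "t ` {..<2} \<subseteq> {1..n}"
    using R by (auto simp: t_def strict_mono_on_def)
  have 3: "\<forall>j<2. \<sigma> (t j) = x ([1, 2] ! j)"
    using R by (auto simp: t_def x_def less_2_cases_iff)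
  have 4: "hat n \<sigma> (x 1) = x 3" using R by (simp add: x_def)
  show ?L unfolding contains_arrow_def arrow_size_alpha
    by (rule exI[of _ x]) (use 1 2 3 4 in \<open>auto simp: alpha_def numeral_2_eq_2\<close>)
qed

end

theory Submission
  imports Defs
begin

text \<open>
  An occurrence of \<open>\<alpha> = (12; 1 \<rightarrow> 3)\<close> in \<open>\<sigma>\<close> always contains the classical patterns 132 and
  312, so avoiding \<open>\<alpha>\<close> is automatic for the permutations being counted, and the two numbers are
  the numbers of permutations avoiding 132 and 312, which are Catalan numbers.

  Cut the one-line word of \<open>\<sigma>\<close> into the cycles of \<open>\<sigma>\<close>-hat, each written with its maximum first.
  Let \<open>x1 < x2 < x3\<close>, with \<open>x1\<close> to the left of \<open>x2\<close> and \<open>\<sigma>\<close>-hat sending \<open>x1\<close> to \<open>x3\<close>. Since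
  \<open>x1 < x3\<close>, the letter \<open>x1\<close> is not the maximum of its block, so that maximum \<open>M\<close> stands before
  \<open>x1\<close>, and \<open>M \<ge> x3\<close> because \<open>x3\<close> is in the same block. The letters \<open>M, x1, x2\<close> form a 312. The letter
  right after \<open>x1\<close> is either \<open>x3\<close> or, at the end of the block, the first letter of the next block,
  which exceeds \<open>M\<close>. Either way it is at least \<open>x3\<close>, hence different from \<open>x2\<close>, and with \<open>x1\<close> and
  \<open>x2\<close> it forms a 132. This is \<open>neighbours_of_hat_excedance\<close> and
  \<open>contains_alpha_imp_contains_132_312\<close>. To reason about \<open>hat\<close>, which is an \<open>inv_into\<close>, one needs
  that \<open>Phi\<close> is a bijection: the blocks can be recovered from the word
  (\<open>concat_blocks_inject\<close>), so \<open>Phi\<close> is injective, and \<open>perms n\<close> is finite.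

  For the count, a word \<open>L m R\<close> with maximal letter \<open>m\<close> avoids 132 iff \<open>L\<close> and \<open>R\<close> do and every
  letter of \<open>L\<close> is at least every letter of \<open>R\<close>; on an interval of values this gives the Catalan
  convolution (\<open>card_avoiders_132\<close>). Replacing each value \<open>x\<close> by \<open>n + 1 - x\<close> exchanges
  132 and 312.
\<close>

section \<open>Words and permutations\<close>

lemma permutes_perm_of_word:
  assumes "distinct w" "set w = {1..n}"
  shows "perm_of_word w permutes {1..n}"
proof (rule bij_imp_permutes)
  have len: "length w = n"
    using assms distinct_card[of w] by simp
  have "bij_betw ((!) w) {..<n} {1..n}"
    using bij_betw_nth[OF assms(1)] len assms(2) by simp
  moreover have "bij_betw (\<lambda>i. i - 1) {1..n} {..<n}"
    by (rule bij_betwI[where g = Suc]) auto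
  ultimately have "bij_betw ((!) w \<circ> (\<lambda>i. i - 1)) {1..n} {1..n}"
    by (rule bij_betw_trans[rotated])
  then show "bij_betw (perm_of_word w) {1..n} {1..n}"
    by (rule bij_betw_cong[THEN iffD1, rotated]) (auto simp: perm_of_word_def len)
  show "perm_of_word w x = x" if "x \<notin> {1..n}" for x
    using that by (auto simp: perm_of_word_def len)
qed

lemma perm_of_word_inject:
  assumes "length v = length w" "perm_of_word v = perm_of_word w"
  shows "v = w"
proof (rule nth_equalityI)
  fix i assume "i < length v"
  then show "v ! i = w ! i"
    using assms(1) fun_cong[OF assms(2), of "Suc i"] by (simp add: perm_of_word_def)
qed (fact assms(1))

lemma perm_of_word_one_line:
  assumes "\<sigma> permutes {1..n}"
  shows "perm_of_word (map \<sigma> [1..<Suc n]) = \<sigma>"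
proof
  fix i
  show "perm_of_word (map \<sigma> [1..<Suc n]) i = \<sigma> i"
    using permutes_not_in[OF assms, of i]
    by (cases "i \<in> {1..n}") (auto simp: perm_of_word_def nth_append simp del: upt_Suc)
qed

lemma bij_betw_one_line:
  "bij_betw (\<lambda>\<sigma>. map \<sigma> [1..<Suc n]) (perms n) {w. distinct w \<and> set w = {1..n}}"
proof (rule bij_betwI[where g = perm_of_word])
  show "(\<lambda>\<sigma>. map \<sigma> [1..<Suc n]) \<in> perms n \<rightarrow> {w. distinct w \<and> set w = {1..n}}"
  proof
    fix \<sigma> assume "\<sigma> \<in> perms n"
    then have "\<sigma> permutes {1..n}"
      by (simp add: perms_def)
    then show "map \<sigma> [1..<Suc n] \<in> {w. distinct w \<and> set w = {1..n}}"
      using permutes_image[of \<sigma> "{1..n}"] permutes_inj_on[of \<sigma> "{1..n}"]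
      by (simp add: distinct_map atLeastLessThanSuc_atLeastAtMost del: upt_Suc)
  qed
next
  show "perm_of_word \<in> {w. distinct w \<and> set w = {1..n}} \<rightarrow> perms n"
    using permutes_perm_of_word unfolding perms_def by blast
next
  fix \<sigma> assume "\<sigma> \<in> perms n"
  then show "perm_of_word (map \<sigma> [1..<Suc n]) = \<sigma>"
    unfolding perms_def using perm_of_word_one_line by blast
next
  fix w :: "nat list" assume w: "w \<in> {w. distinct w \<and> set w = {1..n}}"
  then have len: "length w = n"
    using distinct_card[of w] by simp
  show "map (perm_of_word w) [1..<Suc n] = w"
    by (rule nth_equalityI) (auto simp: perm_of_word_def len simp del: upt_Suc)
qed

section \<open>The standard cycle notation\<close>

lemma hd_support:
  assumes "permutation p"
  shows "support p a \<noteq> []" "hd (support p a) = a"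
  using least_power_of_permutation(2)[OF assms, of a] by (auto simp: hd_map)

lemma support_disjoint_or_eq:
  assumes "permutation p"
  shows "set (support p a) = set (support p b) \<or> set (support p a) \<inter> set (support p b) = {}"
  using disjoint_support[OF assms] unfolding disjoint_def by blast

lemma mem_support_self:
  assumes "permutation p"
  shows "a \<in> set (support p a)"
  using hd_in_set[OF hd_support(1)[OF assms, of a]] unfolding hd_support(2)[OF assms] .

lemma support_subset:
  assumes "\<tau> permutes S" "a \<in> S"
  shows "set (support \<tau> a) \<subseteq> S"
proof -
  have "(\<tau> ^^ i) a \<in> S" for i
    by (induction i) (use assms permutes_in_image[OF assms(1)] in auto)
  then show ?thesis
    by auto
qed

lemma apply_nth_support:
  assumes "permutation p" "c = support p a" "i < length c"
  shows "p (c ! i) = (if Suc i < length c then c ! Suc i else hd c)"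
proof (cases "Suc i < length c")
  case True
  then show ?thesis
    using assms(2) by simp
next
  case False
  then have "Suc i = least_power p a"
    using assms(2,3) by simp
  moreover have "p (c ! i) = (p ^^ Suc i) a"
    using assms(2,3) by simp
  ultimately show ?thesis
    using False least_power_of_permutation(1)[OF assms(1), of a] hd_support(2)[OF assms(1), of a] assms(2)
    by simp
qed

text \<open>
  Each block is the orbit of its own maximum. Distinct orbits are disjoint and each has
  exactly one maximum, so the blocks partition \<open>{1..n}\<close>: an element \<open>x\<close> lies in the block headed by
  the maximum of the orbit of \<open>x\<close>.
\<close>

lemma standard_cycles_properties:
  assumes "\<tau> permutes {1..n}"
  defines "cs \<equiv> standard_cycles n \<tau>"
  shows "\<And>c. c \<in> set cs \<Longrightarrow> c \<noteq> [] \<and> c = support \<tau> (hd c) \<and> (\<forall>x\<in>set (tl c). x < hd c)"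
    and "sorted_wrt (<) (map hd cs)"
    and "distinct (concat cs)" and "set (concat cs) = {1..n}"
proof -
  have perm: "permutation \<tau>"
    using assms(1) permutation_permutes by blast
  let ?M = "sorted_list_of_set (cycle_maxima n \<tau>)"
  have fin: "finite (cycle_maxima n \<tau>)"
    by (simp add: cycle_maxima_def)
  have hds: "map hd cs = ?M"
    unfolding cs_def standard_cycles_def map_map comp_def hd_support(2)[OF perm] by simp
  show "sorted_wrt (<) (map hd cs)"
    unfolding hds by simp
  have cs: "cs = map (support \<tau>) ?M"
    by (simp add: cs_def standard_cycles_def)
  have maxima: "a \<in> {1..n} \<and> (\<forall>x\<in>set (support \<tau> a). x \<le> a)" if "a \<in> set ?M" for a
    using that fin unfolding cycle_maxima_def by simp
  show "c \<noteq> [] \<and> c = support \<tau> (hd c) \<and> (\<forall>x\<in>set (tl c). x < hd c)" if "c \<in> set cs" for c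
  proof -
    obtain a where a: "a \<in> set ?M" "c = support \<tau> a"
      using \<open>c \<in> set cs\<close> unfolding cs set_map by (rule imageE)
    have ne: "c \<noteq> []" "hd c = a"
      unfolding a(2) by (rule hd_support[OF perm])+
    have "distinct c"
      unfolding a(2) by (rule cycle_of_permutation[OF perm])
    then have "hd c \<notin> set (tl c)" "set (tl c) \<subseteq> set c"
      using ne(1) by (cases c; auto)+
    moreover have "\<forall>x\<in>set c. x \<le> a"
      using maxima[OF a(1)] unfolding a(2) by blast
    ultimately have "\<forall>x\<in>set (tl c). x < hd c"
      using ne(2) by (metis order.not_eq_order_implies_strict subsetD)
    then show ?thesis
      using ne a(2) by blast
  qed
  have eq: "a = b" if "a \<in> set ?M" "b \<in> set ?M" "set (support \<tau> a) \<inter> set (support \<tau> b) \<noteq> {}" for a b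
  proof -
    have "set (support \<tau> a) = set (support \<tau> b)"
      using support_disjoint_or_eq[OF perm] that(3) by blast
    then have "a \<in> set (support \<tau> b)" "b \<in> set (support \<tau> a)"
      using mem_support_self[OF perm] by blast+
    then show ?thesis
      using maxima[OF that(1)] maxima[OF that(2)] by (meson order_antisym)
  qed
  have inj: "inj_on (support \<tau>) (set ?M)"
    by (rule inj_onI) (metis hd_support(2)[OF perm])
  show "distinct (concat cs)"
  proof (rule distinct_concat)
    show "distinct cs"
      unfolding cs using inj by (simp add: distinct_map)
    show "distinct c" if "c \<in> set cs" for c
      using that cycle_of_permutation[OF perm] unfolding cs set_map by blast
    show "set c \<inter> set d = {}" if cd: "c \<in> set cs" "d \<in> set cs" "c \<noteq> d" for c d
    proof -
      obtain a where a: "a \<in> set ?M" "c = support \<tau> a"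
        using cd(1) unfolding cs set_map by (rule imageE)
      obtain b where b: "b \<in> set ?M" "d = support \<tau> b"
        using cd(2) unfolding cs set_map by (rule imageE)
      show ?thesis
        using eq[OF a(1) b(1)] cd(3) unfolding a(2) b(2) by metis
    qed
  qed
  have set_concat_cs: "set (concat cs) = (\<Union>a\<in>set ?M. set (support \<tau> a))"
    unfolding cs set_concat set_map image_image ..
  then have "set (concat cs) \<subseteq> {1..n}"
    using support_subset[OF assms(1)] maxima by (metis (no_types, lifting) UN_least)
  moreover have "x \<in> set (concat cs)" if x: "x \<in> {1..n}" for x
  proof -
    \<comment> \<open>the maximum of the orbit of \<open>x\<close> heads the block containing \<open>x\<close>\<close>
    define a where "a = Max (set (support \<tau> x))"
    have a: "a \<in> set (support \<tau> x)"
      unfolding a_def using mem_support_self[OF perm, of x] by (intro Max_in) auto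
    then have sup: "set (support \<tau> a) = set (support \<tau> x)"
      using support_disjoint_or_eq[OF perm] mem_support_self[OF perm, of a] by blast
    have "a \<in> {1..n}"
      using a support_subset[OF assms(1) x] by blast
    moreover have "\<forall>y\<in>set (support \<tau> a). y \<le> a"
      unfolding sup unfolding a_def by simp
    ultimately have "a \<in> set ?M"
      using fin by (simp add: cycle_maxima_def)
    moreover have "x \<in> set (support \<tau> a)"
      unfolding sup by (rule mem_support_self[OF perm])
    ultimately show ?thesis
      unfolding set_concat_cs by (rule UN_I)
  qed
  ultimately show "set (concat cs) = {1..n}"
    by blast
qed

text \<open>
  The borders between blocks are visible in the word: a block ends just before the first letter
  that exceeds its head, because inside the block all letters are smaller and the next head is
  larger. Hence \<open>takeWhile\<close> recovers the first block, and induction does the rest.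
\<close>

lemma concat_blocks_inject:
  fixes css dss :: "'a::linorder list list"
  assumes "\<And>c. c \<in> set css \<Longrightarrow> c \<noteq> [] \<and> (\<forall>x\<in>set (tl c). x < hd c)" "sorted_wrt (<) (map hd css)"
    and "\<And>d. d \<in> set dss \<Longrightarrow> d \<noteq> [] \<and> (\<forall>x\<in>set (tl d). x < hd d)" "sorted_wrt (<) (map hd dss)"
    and "concat css = concat dss"
  shows "css = dss"
  using assms
proof (induction css arbitrary: dss)
  case Nil
  then show ?case
    by (cases dss) auto
next
  case (Cons c css)
  then obtain d ds where dss: "dss = d # ds"
    by (cases dss) auto
  obtain a c' where c: "c = a # c'"
    using Cons.prems(1)[of c] by (cases c) auto
  obtain b d' where d: "d = b # d'"
    using Cons.prems(3)[of d] dss by (cases d) auto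
  have ab: "a = b" and tails: "c' @ concat css = d' @ concat ds"
    using Cons.prems(5) by (simp_all add: dss c d)
  have block: "takeWhile (\<lambda>x. x < a) (e @ concat es) = e"
    if "\<forall>x\<in>set e. x < a" "\<forall>f\<in>set es. f \<noteq> [] \<and> a < hd f" for e es
  proof -
    have "takeWhile (\<lambda>x. x < a) (concat es) = []"
      using that(2) by (cases es) (auto simp: neq_Nil_conv)
    then show ?thesis
      using that(1) by (simp add: takeWhile_append)
  qed
  have "takeWhile (\<lambda>x. x < a) (c' @ concat css) = c'"
    using Cons.prems(1)[of c] Cons.prems(1,2) by (intro block) (auto simp: c)
  moreover have "takeWhile (\<lambda>x. x < a) (d' @ concat ds) = d'"
    using Cons.prems(3)[of d] Cons.prems(3,4) by (intro block) (auto simp: d dss ab)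
  ultimately have "c' = d'"
    using tails by simp
  moreover have "css = ds"
    using Cons.prems tails \<open>c' = d'\<close> by (intro Cons.IH) (auto simp: dss)
  ultimately show ?case
    by (simp add: dss c d ab)
qed

lemma Phi_mem_perms:
  assumes "\<tau> \<in> perms n"
  shows "Phi n \<tau> \<in> perms n"
  using assms standard_cycles_properties(3,4)[of \<tau> n] permutes_perm_of_word
  unfolding perms_def Phi_def by blast

text \<open>
  The word determines the cycles, and each cycle, being the orbit of its head, determines the
  permutation on its elements.
\<close>

lemma inj_on_Phi: "inj_on (Phi n) (perms n)"
proof (rule inj_onI)
  fix \<tau> \<rho> assume "\<tau> \<in> perms n" "\<rho> \<in> perms n" and eq: "Phi n \<tau> = Phi n \<rho>"
  then have \<tau>: "\<tau> permutes {1..n}" and \<rho>: "\<rho> permutes {1..n}"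
    by (auto simp: perms_def)
  note T = standard_cycles_properties[OF \<tau>] and R = standard_cycles_properties[OF \<rho>]
  have "length (concat (standard_cycles n \<tau>)) = length (concat (standard_cycles n \<rho>))"
    using distinct_card[OF T(3)] distinct_card[OF R(3)] T(4) R(4) by simp
  then have "concat (standard_cycles n \<tau>) = concat (standard_cycles n \<rho>)"
    using eq unfolding Phi_def by (rule perm_of_word_inject)
  then have cs: "standard_cycles n \<tau> = standard_cycles n \<rho>"
    using T(1,2) R(1,2) by (intro concat_blocks_inject) blast+
  show "\<tau> = \<rho>"
  proof
    fix x
    show "\<tau> x = \<rho> x"
    proof (cases "x \<in> {1..n}")
      case True
      then obtain c where c: "c \<in> set (standard_cycles n \<tau>)" "x \<in> set c"
        unfolding T(4)[symmetric] set_concat by blast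
      have "c = support \<tau> (hd c)" "c = support \<rho> (hd c)"
        using T(1)[OF c(1)] R(1)[of c] c(1) cs by auto
      moreover have "permutation \<tau>" "permutation \<rho>"
        using \<tau> \<rho> permutation_permutes by blast+
      ultimately show ?thesis
        using cycle_restrict c(2) by metis
    next
      case False
      then show ?thesis
        using permutes_not_in[OF \<tau>] permutes_not_in[OF \<rho>] by simp
    qed
  qed
qed

text \<open>
  \<open>Phi n\<close> is an injective self-map of a finite set, hence surjective, so that the \<open>inv_into\<close> in the
  definition of \<open>hat\<close> is a genuine inverse.
\<close>

lemma hat_props:
  assumes "\<sigma> \<in> perms n"
  shows "hat n \<sigma> \<in> perms n" "Phi n (hat n \<sigma>) = \<sigma>"
proof -
  have "finite (perms n)"
    unfolding perms_def by (rule finite_permutations) simp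
  then have "Phi n ` perms n = perms n"
    by (rule endo_inj_surj) (use Phi_mem_perms inj_on_Phi in auto)
  then have "\<sigma> \<in> Phi n ` perms n"
    using assms by simp
  then show "hat n \<sigma> \<in> perms n" "Phi n (hat n \<sigma>) = \<sigma>"
    unfolding hat_def by (rule inv_into_into f_inv_into_f)+
qed

text \<open>
  An excedance of \<open>\<sigma>\<close>-hat at \<open>x = \<sigma> i\<close> is enclosed by large letters in the word of \<open>\<sigma>\<close>. The head of
  the block of \<open>x\<close> is at least \<open>hat n \<sigma> x\<close>, thus larger than \<open>x\<close>, and precedes \<open>x\<close>. The letter after
  \<open>x\<close> is \<open>hat n \<sigma> x\<close> itself when \<open>x\<close> is not last in its block; otherwise \<open>hat n \<sigma> x\<close> is the head of
  the block, and the next letter is the head of the next block, which is larger still.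
\<close>

lemma neighbours_of_hat_excedance:
  assumes "\<sigma> \<in> perms n" "1 \<le> i" "i < n" "\<sigma> i < hat n \<sigma> (\<sigma> i)"
  shows "hat n \<sigma> (\<sigma> i) \<le> \<sigma> (Suc i)"
    and "\<exists>h. 1 \<le> h \<and> h < i \<and> hat n \<sigma> (\<sigma> i) \<le> \<sigma> h"
proof -
  define \<tau> where "\<tau> = hat n \<sigma>"
  define w where "w = concat (standard_cycles n \<tau>)"
  have \<tau>: "\<tau> permutes {1..n}"
    using hat_props(1)[OF assms(1)] by (simp add: \<tau>_def perms_def)
  then have perm: "permutation \<tau>"
    using permutation_permutes by blast
  note C = standard_cycles_properties[OF \<tau>, folded w_def]
  have len: "length w = n"
    using distinct_card[OF C(3)] C(4) by simp
  have \<sigma>w: "\<sigma> k = w ! (k - 1)" if "1 \<le> k" "k \<le> n" for k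
    using that hat_props(2)[OF assms(1)] len
    by (metis Phi_def \<tau>_def perm_of_word_def w_def)
  have "w ! (i - 1) \<in> set w"
    using assms(2,3) len by simp
  then obtain c where c: "c \<in> set (standard_cycles n \<tau>)" "w ! (i - 1) \<in> set c"
    unfolding w_def by auto
  obtain pre post where split: "standard_cycles n \<tau> = pre @ c # post"
    using c(1) by (meson split_list)
  obtain p where p: "p < length c" "c ! p = w ! (i - 1)"
    using c(2) by (meson in_set_conv_nth)
  let ?q = "length (concat pre)"
  have w: "w = concat pre @ c @ concat post"
    by (simp add: w_def split)
  have inc: "w ! (?q + k) = c ! k" if "k < length c" for k
    using that by (simp add: w nth_append)
  \<comment> \<open>the position of \<open>\<sigma> i\<close> in \<open>w\<close>, counted from 0, is the offset of its block plus \<open>p\<close>\<close>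
  have "w ! (?q + p) = w ! (i - 1)" "?q + p < length w" "i - 1 < length w"
    using p inc[OF p(1)] assms(2,3) len by (simp_all add: w)
  then have "?q + p = i - 1"
    using nth_eq_iff_index_eq[OF C(3)] by blast
  then have i: "i = Suc (?q + p)"
    using assms(2) by simp
  have c0: "c \<noteq> []" "c = support \<tau> (hd c)" "\<forall>x\<in>set (tl c). x < hd c"
    using C(1)[OF c(1)] by auto
  have le: "x \<le> hd c" if "x \<in> set c" for x
    using that c0(1,3) by (cases c) (auto intro: less_imp_le)
  have \<tau>i: "\<tau> (\<sigma> i) = (if Suc p < length c then c ! Suc p else hd c)"
    using apply_nth_support[OF perm c0(2) p(1)] p(2) \<sigma>w[of i] assms(2,3) by simp
  have \<tau>le: "\<tau> (\<sigma> i) \<le> hd c"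
    using \<tau>i le by auto
  have exc: "c ! p < \<tau> (\<sigma> i)"
    using assms(4) p(2) \<sigma>w[of i] assms(2,3) by (simp add: \<tau>_def)
  have "p \<noteq> 0"
    using exc \<tau>le hd_conv_nth[OF c0(1)] by (metis leD)
  moreover have "\<sigma> (Suc ?q) = hd c"
    using \<sigma>w[of "Suc ?q"] inc[of 0] c0(1) i assms(3) by (simp add: hd_conv_nth)
  ultimately show "\<exists>h. 1 \<le> h \<and> h < i \<and> hat n \<sigma> (\<sigma> i) \<le> \<sigma> h"
    using \<tau>le i by (intro exI[of _ "Suc ?q"]) (simp add: \<tau>_def)
  have \<sigma>Suc: "\<sigma> (Suc i) = w ! (?q + Suc p)"
    using \<sigma>w[of "Suc i"] assms(3) i by simp
  show "hat n \<sigma> (\<sigma> i) \<le> \<sigma> (Suc i)"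
  proof (cases "Suc p < length c")
    case True
    then show ?thesis
      using \<tau>i \<sigma>Suc inc[OF True] by (simp add: \<tau>_def)
  next
    case False
    then have last: "length c = Suc p"
      using p(1) by simp
    have "post \<noteq> []"
      using assms(3) len i last w by auto
    then obtain d ds where post: "post = d # ds"
      by (cases post) auto
    have "d \<noteq> []" "hd c < hd d"
      using C(1)[of d] C(2) by (auto simp: split post sorted_wrt_append)
    moreover have "w ! (?q + Suc p) = hd d"
      using \<open>d \<noteq> []\<close> last by (simp add: w post nth_append hd_conv_nth)
    ultimately show ?thesis
      using \<tau>le \<sigma>Suc by (simp add: \<tau>_def)
  qed
qed

section \<open>Patterns of length three in words\<close>

text \<open>
  \<open>P x y z\<close> says that three letters, read from left to right, form the pattern. Recursion through
  \<open>sorted_wrt\<close>, instead of quantification over positions, makes the behaviour under append and map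
  available by rewriting.
\<close>

fun avoids :: "('a \<Rightarrow> 'a \<Rightarrow> 'a \<Rightarrow> bool) \<Rightarrow> 'a list \<Rightarrow> bool" where
  "avoids P [] \<longleftrightarrow> True"
| "avoids P (x # xs) \<longleftrightarrow> sorted_wrt (\<lambda>y z. \<not> P x y z) xs \<and> avoids P xs"

lemma avoids_map: "avoids P (map f w) \<longleftrightarrow> avoids (\<lambda>x y z. P (f x) (f y) (f z)) w"
  by (induction w) (auto simp: sorted_wrt_map)

lemma avoids_cong:
  assumes "\<And>x y z. x \<in> set w \<Longrightarrow> y \<in> set w \<Longrightarrow> z \<in> set w \<Longrightarrow> P x y z \<longleftrightarrow> Q x y z"
  shows "avoids P w \<longleftrightarrow> avoids Q w"
  using assms
proof (induction w)
  case (Cons x w)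
  have "sorted_wrt (\<lambda>y z. \<not> P x y z) w \<longleftrightarrow> sorted_wrt (\<lambda>y z. \<not> Q x y z) w"
    using Cons.prems by (auto intro: sorted_wrt_mono_rel[rotated])
  then show ?case
    using Cons by auto
qed simp

lemma sorted_wrt_increasing_iff:
  fixes w :: "'a::linorder list"
  assumes "sorted_wrt (<) w"
  shows "sorted_wrt R w \<longleftrightarrow> (\<forall>y\<in>set w. \<forall>z\<in>set w. y < z \<longrightarrow> R y z)"
  using assms by (induction w) auto

text \<open>
  Applied to the list of positions \<open>[1..<Suc n]\<close>, this turns the recursive notion into the one
  with indices, see \<open>avoids_one_line_iff\<close> below.
\<close>

lemma avoids_increasing_iff:
  fixes w :: "'a::linorder list"
  assumes "sorted_wrt (<) w"
  shows "avoids P w \<longleftrightarrow>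
    (\<forall>x\<in>set w. \<forall>y\<in>set w. \<forall>z\<in>set w. x < y \<and> y < z \<longrightarrow> \<not> P x y z)"
  using assms
proof (induction w)
  case (Cons x w)
  then have "sorted_wrt (\<lambda>y z. \<not> P x y z) w \<longleftrightarrow>
      (\<forall>y\<in>set w. \<forall>z\<in>set w. y < z \<longrightarrow> \<not> P x y z)"
    by (intro sorted_wrt_increasing_iff) simp
  with Cons show ?case
    by simp (meson less_asym less_trans)
qed simp

definition pattern_132 :: "'a::linorder \<Rightarrow> 'a \<Rightarrow> 'a \<Rightarrow> bool" where
  "pattern_132 x y z \<longleftrightarrow> x < z \<and> z < y"

definition pattern_312 :: "'a::linorder \<Rightarrow> 'a \<Rightarrow> 'a \<Rightarrow> bool" where
  "pattern_312 x y z \<longleftrightarrow> y < z \<and> z < x"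

lemma contains_classical_three_iff:
  "contains_classical n \<sigma> 3 \<pi> \<longleftrightarrow>
    (\<exists>i j k. 1 \<le> i \<and> i < j \<and> j < k \<and> k \<le> n \<and>
      (\<sigma> i < \<sigma> j \<longleftrightarrow> \<pi> 1 < \<pi> 2) \<and> (\<sigma> j < \<sigma> i \<longleftrightarrow> \<pi> 2 < \<pi> 1) \<and>
      (\<sigma> i < \<sigma> k \<longleftrightarrow> \<pi> 1 < \<pi> 3) \<and> (\<sigma> k < \<sigma> i \<longleftrightarrow> \<pi> 3 < \<pi> 1) \<and>
      (\<sigma> j < \<sigma> k \<longleftrightarrow> \<pi> 2 < \<pi> 3) \<and> (\<sigma> k < \<sigma> j \<longleftrightarrow> \<pi> 3 < \<pi> 2))"
  (is "_ \<longleftrightarrow> (\<exists>i j k. ?Q i j k)")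
proof -
  have three: "{1..3} = {1, 2, 3::nat}"
    by auto
  show ?thesis
  proof
    assume "contains_classical n \<sigma> 3 \<pi>"
    then obtain t where "strict_mono_on {1..3} t" "t ` {1..3} \<subseteq> {1..n}"
      "\<forall>i\<in>{1..3}. \<forall>j\<in>{1..3}. \<sigma> (t i) < \<sigma> (t j) \<longleftrightarrow> \<pi> i < \<pi> j"
      unfolding contains_classical_def by blast
    then have "?Q (t 1) (t 2) (t 3)"
      unfolding three strict_mono_on_def by simp
    then show "\<exists>i j k. ?Q i j k"
      by blast
  next
    assume "\<exists>i j k. ?Q i j k"
    then obtain i j k where Q: "?Q i j k"
      by blast
    let ?t = "\<lambda>l::nat. if l = 1 then i else if l = 2 then j else k"
    have "strict_mono_on {1..3} ?t" "?t ` {1..3} \<subseteq> {1..n}"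
      "\<forall>a\<in>{1..3}. \<forall>b\<in>{1..3}. \<sigma> (?t a) < \<sigma> (?t b) \<longleftrightarrow> \<pi> a < \<pi> b"
      unfolding three strict_mono_on_def using Q by auto
    then show "contains_classical n \<sigma> 3 \<pi>"
      unfolding contains_classical_def by blast
  qed
qed

lemma contains_132_iff:
  "contains_classical n \<sigma> 3 (perm_of_word [1, 3, 2]) \<longleftrightarrow>
    (\<exists>i j k. 1 \<le> i \<and> i < j \<and> j < k \<and> k \<le> n \<and> pattern_132 (\<sigma> i) (\<sigma> j) (\<sigma> k))"
proof -
  have "perm_of_word [1, 3, 2] 1 = 1" "perm_of_word [1, 3, 2] 2 = 3" "perm_of_word [1, 3, 2] 3 = 2"
    by (simp_all add: perm_of_word_def)
  then show ?thesis
    unfolding contains_classical_three_iff pattern_132_def by (intro arg_cong[where f = Ex] ext) auto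
qed

lemma contains_312_iff:
  "contains_classical n \<sigma> 3 (perm_of_word [3, 1, 2]) \<longleftrightarrow>
    (\<exists>i j k. 1 \<le> i \<and> i < j \<and> j < k \<and> k \<le> n \<and> pattern_312 (\<sigma> i) (\<sigma> j) (\<sigma> k))"
proof -
  have "perm_of_word [3, 1, 2] 1 = 3" "perm_of_word [3, 1, 2] 2 = 1" "perm_of_word [3, 1, 2] 3 = 2"
    by (simp_all add: perm_of_word_def)
  then show ?thesis
    unfolding contains_classical_three_iff pattern_312_def by (intro arg_cong[where f = Ex] ext) auto
qed

lemma avoids_one_line_iff:
  "avoids P (map \<sigma> [1..<Suc n]) \<longleftrightarrow>
    (\<nexists>i j k. 1 \<le> i \<and> i < j \<and> j < k \<and> k \<le> n \<and> P (\<sigma> i) (\<sigma> j) (\<sigma> k))"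
proof -
  have "sorted_wrt (<) [1..<Suc n]"
    by (rule sorted_wrt_upt)
  then show ?thesis
    unfolding avoids_map avoids_increasing_iff[OF \<open>sorted_wrt (<) [1..<Suc n]\<close>]
    by (auto simp del: upt_Suc)
qed

section \<open>Catalan numbers\<close>

lemma catalan_0: "catalan 0 = 1"
  by (simp add: catalan_def)

lemma catalan_Suc: "(real n + 2) * catalan (Suc n) = (4 * real n + 2) * catalan n"
proof -
  have "real (2 * Suc n choose Suc n) * (real n + 1) = (4 * real n + 2) * real (2 * n choose n)"
  proof -
    have central: "real (2 * k choose k) = fact (2 * k) / (fact k * fact k)" for k
      using binomial_fact[of k "2 * k", where 'a = real] by simp
    have "(fact (2 * Suc n) :: real) = (2 * real n + 2) * (2 * real n + 1) * fact (2 * n)"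
      by (simp add: algebra_simps)
    then have "real (2 * Suc n choose Suc n) * (real n + 1) =
        (2 * real n + 2) * (2 * real n + 1) * fact (2 * n) /
        (((real n + 1) * fact n) * ((real n + 1) * fact n)) * (real n + 1)"
      unfolding central by (simp add: add.commute)
    also have "\<dots> = (4 * real n + 2) * (fact (2 * n) / (fact n * fact n))"
      by (simp add: divide_simps) (simp add: algebra_simps)
    finally show ?thesis
      unfolding central .
  qed
  moreover have "real (n + 1) \<noteq> 0" "real (n + 2) \<noteq> 0"
    by simp_all
  ultimately show ?thesis
    unfolding catalan_def
    by (simp add: divide_simps del: binomial_Suc_Suc mult_Suc_right)
      (simp add: algebra_simps del: binomial_Suc_Suc mult_Suc_right)
qed

text \<open>
  With \<open>S n\<close> the convolution sum and \<open>T n\<close> the same sum weighted by \<open>i\<close>, the symmetry \<open>i \<leftrightarrow> n - i\<close>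
  gives \<open>2 T n = n S n\<close>. Expanding \<open>T (n + 1) + S (n + 1)\<close>, whose weights are \<open>i + 1\<close>, with
  the first-order recurrence \<open>(i + 2) C (i + 1) = (4 i + 2) C i\<close> expresses it by \<open>C (n + 1)\<close>,
  \<open>T n\<close> and \<open>S n\<close>. The result is a recurrence for \<open>S\<close> that matches the one for \<open>C\<close>, which
  replaces the usual generating function argument.
\<close>

lemma catalan_convolution: "(\<Sum>i\<le>n. catalan i * catalan (n - i)) = catalan (Suc n)"
proof (induction n)
  case 0
  then show ?case
    by (simp add: catalan_def)
next
  case (Suc n)
  define S where "S n = (\<Sum>i\<le>n. catalan i * catalan (n - i))" for n
  define T where "T n = (\<Sum>i\<le>n. real i * (catalan i * catalan (n - i)))" for n
  have T: "2 * T n = real n * S n" for n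
  proof -
    have "T n = (\<Sum>i\<le>n. real (n - i) * (catalan i * catalan (n - i)))"
      unfolding T_def using sum.nat_diff_reindex[of "\<lambda>i. real i * (catalan i * catalan (n - i))" "Suc n"]
      by (simp add: lessThan_Suc_atMost mult.commute cong: sum.cong_simp)
    then have "2 * T n = (\<Sum>i\<le>n. real i * (catalan i * catalan (n - i)) +
        real (n - i) * (catalan i * catalan (n - i)))"
      unfolding sum.distrib T_def by simp
    also have "\<dots> = (\<Sum>i\<le>n. real n * (catalan i * catalan (n - i)))"
      by (intro sum.cong) (auto simp: of_nat_diff algebra_simps)
    finally show ?thesis
      by (simp add: S_def sum_distrib_left)
  qed
  have "T (Suc n) + S (Suc n) = (\<Sum>i\<le>Suc n. (real i + 1) * catalan i * catalan (Suc n - i))"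
    unfolding T_def S_def sum.distrib[symmetric] by (simp add: algebra_simps)
  also have "\<dots> = catalan (Suc n) + (\<Sum>i\<le>n. (real i + 2) * catalan (Suc i) * catalan (n - i))"
    unfolding sum.atMost_Suc_shift by (simp add: catalan_0 algebra_simps)
  also have "(\<Sum>i\<le>n. (real i + 2) * catalan (Suc i) * catalan (n - i)) = 4 * T n + 2 * S n"
    unfolding catalan_Suc T_def S_def sum_distrib_left sum.distrib[symmetric]
    by (simp add: algebra_simps)
  finally have "(real n + 3) * S (Suc n) = 2 * ((2 * real n + 3) * catalan (Suc n))"
    using T[of n] T[of "Suc n"] Suc.IH by (simp add: S_def[symmetric] algebra_simps)
  moreover have "(real n + 3) * catalan (Suc (Suc n)) = 2 * ((2 * real n + 3) * catalan (Suc n))"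
    using catalan_Suc[of "Suc n"] by (simp add: algebra_simps)
  ultimately have "(real n + 3) * S (Suc n) = (real n + 3) * catalan (Suc (Suc n))"
    by simp
  then show ?case
    by (simp add: S_def[symmetric])
qed

section \<open>Counting the avoiders of 132 and 312\<close>

definition avoiders :: "('a \<Rightarrow> 'a \<Rightarrow> 'a \<Rightarrow> bool) \<Rightarrow> 'a set \<Rightarrow> 'a list set" where
  "avoiders P S = {w. distinct w \<and> set w = S \<and> avoids P w}"

lemma finite_avoiders:
  assumes "finite S"
  shows "finite (avoiders P S)"
proof (rule finite_subset)
  show "avoiders P S \<subseteq> {w. set w \<subseteq> S \<and> length w \<le> card S}"
    unfolding avoiders_def using distinct_card by fastforce
qed (rule finite_lists_length_le[OF assms])

text \<open>
  The maximum can only play the role of 3, so the only new constraint comes from a letter of \<open>L\<close>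
  and a letter of \<open>R\<close> around it. If every letter of \<open>R\<close> is at most every letter of \<open>L\<close>, then no
  occurrence of 132 begins in \<open>L\<close> and ends in \<open>R\<close>.
\<close>

lemma avoids_132_split_max:
  fixes m :: "'a::linorder"
  assumes "\<forall>x\<in>set L \<union> set R. x < m"
  shows "avoids pattern_132 (L @ m # R) \<longleftrightarrow>
    avoids pattern_132 L \<and> avoids pattern_132 R \<and> (\<forall>x\<in>set L. \<forall>y\<in>set R. y \<le> x)"
  using assms
proof (induction L)
  case Nil
  have "sorted_wrt (\<lambda>y z. \<not> pattern_132 m y z) R"
    using Nil by (induction R) (auto simp: pattern_132_def)
  then show ?case
    by simp
next
  case (Cons x L)
  have below: "\<forall>y\<in>set L. \<not> pattern_132 x y m"
    using Cons.prems by (auto simp: pattern_132_def dest: order.strict_trans)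
  have over: "(\<forall>y\<in>set R. \<not> pattern_132 x m y) \<longleftrightarrow> (\<forall>y\<in>set R. y \<le> x)"
    using Cons.prems by (auto simp: pattern_132_def not_less)
  have "sorted_wrt (\<lambda>y z. \<not> pattern_132 x y z) R"
    "\<forall>y\<in>set L. \<forall>z\<in>set R. \<not> pattern_132 x y z" if "\<forall>y\<in>set R. y \<le> x"
    using that by (induction R) (auto simp: pattern_132_def)
  then show ?case
    using Cons.IH Cons.prems below over by (auto simp: sorted_wrt_append)
qed

lemma interval_cut:
  fixes a n :: nat
  assumes "A \<union> B = {a..<a + n}" "\<forall>x\<in>A. \<forall>y\<in>B. y < x"
  shows "\<exists>k\<le>n. B = {a..<a + k} \<and> A = {a + k..<a + n}"
proof (cases "B = {}")
  case True
  then show ?thesis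
    using assms(1) by (intro exI[of _ 0]) auto
next
  case False
  have fin: "finite B"
    using assms(1) by (metis finite_Un finite_atLeastLessThan)
  define M where "M = Max B"
  have M: "M \<in> B" "\<And>y. y \<in> B \<Longrightarrow> y \<le> M"
    using fin False by (simp_all add: M_def)
  have M_bounds: "a \<le> M" "M < a + n"
    using M(1) assms(1) by auto
  have "x \<in> B" if "a \<le> x" "x \<le> M" for x
  proof -
    have "x \<in> A \<union> B"
      unfolding assms(1) using that M_bounds by auto
    then show ?thesis
      using assms(2) M(1) that(2) by (auto simp: not_less[symmetric])
  qed
  moreover have "B \<subseteq> {a..M}" "A \<subseteq> {M<..<a + n}"
    using M assms by auto
  moreover have "{M<..<a + n} \<subseteq> A \<union> B"
    unfolding assms(1) using M_bounds by auto
  ultimately have "B = {a..M}" "A = {M<..<a + n}"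
    by fastforce+
  then show ?thesis
    using M_bounds by (intro exI[of _ "Suc M - a"]) auto
qed

text \<open>
  Here \<open>k\<close> is the number of letters after the maximum \<open>a + n\<close>; these are the \<open>k\<close> smallest values.
  Since the parts are again intervals of values, a count for all intervals of a given length
  satisfies a recurrence, which is why the lower end \<open>a\<close> is arbitrary.
\<close>

lemma avoiders_132_decomposition:
  fixes a n :: nat
  shows "avoiders pattern_132 {a..<a + Suc n} = (\<lambda>(L, R). L @ (a + n) # R) `
    (\<Union>k\<le>n. avoiders pattern_132 {a + k..<a + n} \<times> avoiders pattern_132 {a..<a + k})"
    (is "?W = ?f ` ?D")
proof
  show "?W \<subseteq> ?f ` ?D"
  proof
    fix w assume "w \<in> ?W"
    then have w: "distinct w" "set w = {a..<a + Suc n}" "avoids pattern_132 w"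
      by (simp_all add: avoiders_def)
    then have "a + n \<in> set w"
      by simp
    then obtain L R where LR: "w = L @ (a + n) # R"
      by (meson split_list)
    have sets: "set L \<union> set R = {a..<a + n}"
    proof -
      have "set L \<union> set R = set w - {a + n}"
        using w(1) by (auto simp: LR)
      also have "\<dots> = {a..<a + n}"
        unfolding w(2) by auto
      finally show ?thesis .
    qed
    then have "\<forall>x\<in>set L \<union> set R. x < a + n"
      by simp
    note av = avoids_132_split_max[OF this, folded LR]
    have "\<forall>x\<in>set L. \<forall>y\<in>set R. y < x"
      using av w(1,3) by (auto simp: LR order.strict_iff_order)
    then obtain k where "k \<le> n" "set R = {a..<a + k}" "set L = {a + k..<a + n}"
      using interval_cut[OF sets] by blast
    then have "(L, R) \<in> ?D"
      using av w(1,3) by (auto simp: avoiders_def LR)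
    then show "w \<in> ?f ` ?D"
      using LR by (intro image_eqI[of _ _ "(L, R)"]) simp_all
  qed
  show "?f ` ?D \<subseteq> ?W"
  proof clarify
    fix L R k
    assume "k \<le> n" and L: "L \<in> avoiders pattern_132 {a + k..<a + n}"
      and R: "R \<in> avoiders pattern_132 {a..<a + k}"
    then have "avoids pattern_132 (L @ (a + n) # R)"
      by (subst avoids_132_split_max) (auto simp: avoiders_def)
    then show "L @ (a + n) # R \<in> ?W"
      using L R \<open>k \<le> n\<close> by (auto simp: avoiders_def)
  qed
qed

lemma card_avoiders_132: "real (card (avoiders pattern_132 {a..<a + n})) = catalan n"
  for a n :: nat
proof (induction n arbitrary: a rule: less_induct)
  case (less n)
  show ?case
  proof (cases n)
    case 0
    have "avoiders pattern_132 ({} :: nat set) = {[]}"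
      by (auto simp: avoiders_def)
    then show ?thesis
      by (simp add: 0 catalan_0)
  next
    case (Suc m)
    let ?P = "\<lambda>k. avoiders pattern_132 {a + k..<a + m} \<times> avoiders pattern_132 {a..<a + k}"
    have "inj_on (\<lambda>(L, R). L @ (a + m) # R) (\<Union>k\<le>m. ?P k)"
      by (rule inj_onI) (auto simp: avoiders_def append_Cons_eq_iff)
    then have "card (avoiders pattern_132 {a..<a + n}) = card (\<Union>k\<le>m. ?P k)"
      unfolding Suc avoiders_132_decomposition by (rule card_image)
    also have "\<dots> = (\<Sum>k\<le>m. card (?P k))"
    proof (rule card_UN_disjoint)
      \<comment> \<open>the letters after the maximum determine \<open>k\<close>\<close>
      have "j = k" if "R \<in> avoiders pattern_132 {a..<a + j}" "R \<in> avoiders pattern_132 {a..<a + k}"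
        for R j k
      proof -
        have "card {a..<a + j} = card {a..<a + k}"
          using that by (simp add: avoiders_def)
        then show ?thesis
          by simp
      qed
      then show "\<forall>i\<in>{..m}. \<forall>j\<in>{..m}. i \<noteq> j \<longrightarrow> ?P i \<inter> ?P j = {}"
        by blast
    qed (auto intro: finite_avoiders)
    also have "real \<dots> = (\<Sum>k\<le>m. catalan (m - k) * catalan k)"
    proof (unfold of_nat_sum, rule sum.cong)
      fix k assume "k \<in> {..m}"
      then have "{a + k..<a + m} = {a + k..<(a + k) + (m - k)}"
        by simp
      moreover have "real (card (avoiders pattern_132 {a..<a + k})) = catalan k"
        using \<open>k \<in> {..m}\<close> Suc by (intro less.IH) simp
      moreover have "real (card (avoiders pattern_132 {a + k..<(a + k) + (m - k)})) = catalan (m - k)"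
        using Suc by (intro less.IH) simp
      ultimately show "real (card (?P k)) = catalan (m - k) * catalan k"
        by (simp add: card_cartesian_product)
    qed simp
    also have "\<dots> = catalan n"
      using catalan_convolution[of m] by (simp add: Suc mult.commute)
    finally show ?thesis .
  qed
qed

text \<open>
  The complement \<open>x \<mapsto> n + 1 - x\<close> is an order-reversing involution of the values and takes the
  pattern 132 to 312.
\<close>

lemma card_avoiders_312: "card (avoiders pattern_312 {1..n}) = card (avoiders pattern_132 {1..n})"
  for n :: nat
proof (rule bij_betw_same_card[OF bij_betwI])
  let ?c = "map (\<lambda>x. Suc n - x)"
  have mem: "?c w \<in> avoiders Q {1..n}"
    if w: "w \<in> avoiders P {1..n}"
      and PQ: "\<And>x y z. x \<in> {1..n} \<Longrightarrow> y \<in> {1..n} \<Longrightarrow> z \<in> {1..n} \<Longrightarrow>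
        Q (Suc n - x) (Suc n - y) (Suc n - z) = P x y z" for P Q w
  proof -
    have bij: "bij_betw (\<lambda>x. Suc n - x) {1..n} {1..n}"
      by (rule bij_betwI[where g = "\<lambda>x. Suc n - x"]) auto
    have "avoids Q (?c w) \<longleftrightarrow> avoids P w"
      unfolding avoids_map using w PQ by (intro avoids_cong) (auto simp: avoiders_def)
    moreover have "distinct (?c w)" "set (?c w) = {1..n}"
      using w bij by (auto simp: avoiders_def distinct_map bij_betw_def)
    ultimately show ?thesis
      using w by (simp add: avoiders_def)
  qed
  show "?c \<in> avoiders pattern_312 {1..n} \<rightarrow> avoiders pattern_132 {1..n}"
  proof
    fix w :: "nat list" assume "w \<in> avoiders pattern_312 {1..n}"
    then show "?c w \<in> avoiders pattern_132 {1..n}"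
      by (rule mem) (auto simp: pattern_312_def pattern_132_def)
  qed
  show "?c \<in> avoiders pattern_132 {1..n} \<rightarrow> avoiders pattern_312 {1..n}"
  proof
    fix w :: "nat list" assume "w \<in> avoiders pattern_132 {1..n}"
    then show "?c w \<in> avoiders pattern_312 {1..n}"
      by (rule mem) (auto simp: pattern_312_def pattern_132_def)
  qed
  have "?c (?c w) = w" if "w \<in> avoiders P {1..n}" for w P
    using that by (auto simp: avoiders_def intro!: map_idI)
  then show "?c (?c w) = w" if "w \<in> avoiders pattern_312 {1..n}" for w
    using that by blast
  show "?c (?c w) = w" if "w \<in> avoiders pattern_132 {1..n}" for w
    using that by (auto simp: avoiders_def intro!: map_idI)
qed

section \<open>The arrow pattern forces both classical patterns\<close>

text \<open>
  With \<open>x1 = \<sigma> i\<close> and \<open>x2 = \<sigma> j\<close>, both large letters around \<open>x1\<close> exceed \<open>x2\<close>. The one on the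
  left gives 312. The one at \<open>Suc i\<close> differs from \<open>x2\<close>, so \<open>x2\<close> comes after it, which gives 132.
\<close>

lemma contains_alpha_imp_contains_132_312:
  assumes "\<sigma> \<in> perms n" "contains_arrow n \<sigma> alpha"
  shows "contains_classical n \<sigma> 3 (perm_of_word [1, 3, 2])"
    and "contains_classical n \<sigma> 3 (perm_of_word [3, 1, 2])"
proof -
  obtain x2 i j where ij: "1 \<le> i" "i < j" "j \<le> n" "\<sigma> j = x2"
    and x2: "\<sigma> i < x2" "x2 < hat n \<sigma> (\<sigma> i)"
    using assms(2) unfolding contains_alpha_iff by blast
  have "i < n" "\<sigma> i < hat n \<sigma> (\<sigma> i)"
    using ij x2 by simp_all
  note nb = neighbours_of_hat_excedance[OF assms(1) ij(1) this]
  obtain h where h: "1 \<le> h" "h < i" "x2 < \<sigma> h"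
    using nb(2) x2(2) by (auto intro: less_le_trans)
  have "x2 < \<sigma> (Suc i)"
    using nb(1) x2(2) by simp
  moreover from this have "Suc i < j"
    using ij(2,4) by (cases "j = Suc i") auto
  ultimately show "contains_classical n \<sigma> 3 (perm_of_word [1, 3, 2])"
    unfolding contains_132_iff pattern_132_def using ij x2(1)
    by (intro exI[of _ i] exI[of _ "Suc i"] exI[of _ j]) simp
  show "contains_classical n \<sigma> 3 (perm_of_word [3, 1, 2])"
    unfolding contains_312_iff pattern_312_def using ij x2(1) h
    by (intro exI[of _ h] exI[of _ i] exI[of _ j]) simp
qed

text \<open>
  If the arrow pattern \<open>A\<close> forces the classical pattern \<open>\<pi>\<close>, avoiding \<open>A\<close> imposes no further
  condition, and the one-line notation carries the permutations to words.
\<close>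

lemma num_avoid_eq_card_avoiders:
  assumes contains_iff: "\<And>\<sigma>. contains_classical n \<sigma> 3 \<pi> \<longleftrightarrow>
      (\<exists>i j k. 1 \<le> i \<and> i < j \<and> j < k \<and> k \<le> n \<and> P (\<sigma> i) (\<sigma> j) (\<sigma> k))"
    and arrow: "\<And>\<sigma>. \<sigma> \<in> perms n \<Longrightarrow> contains_arrow n \<sigma> A \<Longrightarrow> contains_classical n \<sigma> 3 \<pi>"
  shows "num_avoid n \<pi> A = card (avoiders P {1..n})"
proof -
  let ?one_line = "\<lambda>\<sigma> :: nat \<Rightarrow> nat. map \<sigma> [1..<Suc n]"
  let ?S = "{\<sigma> \<in> perms n. avoids P (?one_line \<sigma>)}"
  have "{\<sigma> \<in> perms n. \<not> contains_classical n \<sigma> 3 \<pi> \<and> \<not> contains_arrow n \<sigma> A} = ?S"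
    unfolding avoids_one_line_iff contains_iff[symmetric] using arrow by blast
  moreover have "bij_betw ?one_line ?S (avoiders P {1..n})"
  proof (rule bij_betw_subset[OF bij_betw_one_line])
    have "?one_line ` ?S = {w \<in> ?one_line ` perms n. avoids P w}"
      by blast
    also have "\<dots> = avoiders P {1..n}"
      unfolding bij_betw_imp_surj_on[OF bij_betw_one_line] avoiders_def by simp
    finally show "?one_line ` ?S = avoiders P {1..n}" .
  qed blast
  ultimately show ?thesis
    unfolding num_avoid_def by (simp only: bij_betw_same_card)
qed

theorem theorem3p2:
  fixes n :: nat
  assumes "n \<ge> 2"
  shows "real (num_avoid n (perm_of_word [1, 3, 2]) alpha) = catalan n \<and>
         real (num_avoid n (perm_of_word [3, 1, 2]) alpha) = catalan n"
proof -
  have "num_avoid n (perm_of_word [1, 3, 2]) alpha = card (avoiders pattern_132 {1..n})"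
    by (rule num_avoid_eq_card_avoiders)
      (fact contains_132_iff contains_alpha_imp_contains_132_312(1))+
  moreover have "num_avoid n (perm_of_word [3, 1, 2]) alpha = card (avoiders pattern_312 {1..n})"
    by (rule num_avoid_eq_card_avoiders)
      (fact contains_312_iff contains_alpha_imp_contains_132_312(2))+
  moreover have "real (card (avoiders pattern_132 {1..n})) = catalan n"
    using card_avoiders_132[of 1 n] by (simp add: atLeastLessThanSuc_atLeastAtMost)
  ultimately show ?thesis
    by (simp only: card_avoiders_312)
qed

end
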